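(* Let $\Gamma$ be a concave, strictly decreasing curve in the first quadrant whose $x$- and $y$-intercepts are both equal to $L>0$. Then there exist constants $s_1,s_2>0$ (depending on $\Gamma$) such that $$S(r)\subset[s_1,s_2]\qquad\text{for all } r\ge 2/L .$$ Furthermore, for every $\varepsilon>0$ there is $r_0>0$ such that $$S(r)\subset\Big[\frac{1}{4+\varepsilon},\,4+\varepsilon\Big]\qquad\text{for all } r\ge r_0 .$$
   Context: $\mathbb{N}=\{1,2,3,\dots\}$. The curve $\Gamma$ is the graph $y=f(x)$, $x\in[0,L]$, of a continuous, concave, strictly decreasing function $f:[0,L]\to[0,L]$ with $f(0)=L$ and $f(L)=0$. For $r,s>0$, the curve $r\Gamma(s)$ is the image of $\Gamma$ under $(x,y)\mapsto(rs^{-1}x,\,rsy)$, i.e. the graph of $x\mapsto rsf(sx/r)$ on $[0,rs^{-1}L]$. The number of positive-integer lattice points inside or on $r\Gamma(s)$ is $$N(r,s)=\#\{(j,k)\in\mathbb{N}\times\mathbb{N}: js/r\le L,\ k\le rsf(js/r)\}.$$ For each $r>0$ the function $s\mapsto N(r,s)$ attains its maximum over $s>0$, and $S(r)=\operatorname{arg\,max}_{s>0}N(r,s)$ denotes the set of all maximizing values of $s$. *)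

theory Defs
  imports "HOL-Analysis.Analysis"
begin

text \<open>
  The curve is the graph of \<open>f\<close> on \<open>[0, L]\<close>; the values of the total function \<open>f\<close> outside
  this interval are irrelevant.
\<close>

definition intercept_curve :: "real \<Rightarrow> (real \<Rightarrow> real) \<Rightarrow> bool" where
  "intercept_curve L f \<longleftrightarrow>
     0 < L \<and>
     f ` {0..L} \<subseteq> {0..L} \<and>
     continuous_on {0..L} f \<and>
     concave_on {0..L} f \<and>
     strict_antimono_on {0..L} f \<and>
     f 0 = L \<and> f L = 0"

text \<open>
  Meaningful for \<open>r, s > 0\<close>, where the set is finite: its members satisfy
  \<open>j \<le> r * L / s\<close> and \<open>k \<le> r * s * L\<close>.
\<close>

definition lattice_count :: "real \<Rightarrow> (real \<Rightarrow> real) \<Rightarrow> real \<Rightarrow> real \<Rightarrow> nat" where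
  "lattice_count L f r s =
     card {(j :: nat, k :: nat). 1 \<le> j \<and> 1 \<le> k \<and>
             real j * s / r \<le> L \<and> real k \<le> r * s * f (real j * s / r)}"

definition optimal_stretch :: "real \<Rightarrow> (real \<Rightarrow> real) \<Rightarrow> real \<Rightarrow> real set" where
  "optimal_stretch L f r = {s. is_arg_max (lattice_count L f r) (\<lambda>t. 0 < t) s}"

end

theory Submission
  imports Defs
begin

text \<open>
  Counted column by column, the lattice count is a rounded-down Riemann sum. With step
  \<open>h = s / r\<close> and \<open>n\<close> columns, it is the sum of the floors of
  \<open>r * s * f (j * h) = r\<^sup>2 * (h * f (j * h))\<close> for \<open>1 \<le> j \<le> n\<close>; so, up to rounding, it is
  \<open>r\<^sup>2\<close> times the right Riemann sum of \<open>f\<close> with step \<open>h\<close>. Since \<open>f\<close> decreases, this sum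
  lies below the area \<open>A\<close> under the curve, and concavity makes the deficit linear in \<open>h\<close>:
  between consecutive sample points the curve lies above its chord, so that each strip
  loses at least the triangle above its rectangle, and the triangles telescope to
  \<open>h / 2 * (f 0 - f (n * h))\<close> (\<open>concave_lower_sum_le\<close>). With \<open>x = n * h\<close> for the last sample
  point this gives
  \<open>N(r, s) \<le> r\<^sup>2 * A - r * s / 2 * (L - f x)\<close> (\<open>lattice_count_upper_bound\<close>).

  For \<open>s = 1\<close> the Riemann sum and the rounding each cost at most \<open>r * L\<close>, whence
  \<open>N(r, 1) \<ge> r\<^sup>2 * A - 2 * r * L\<close> (\<open>lattice_count_lower_bound\<close>). A maximizer \<open>s\<close> does at least
  as well as \<open>1\<close>, and comparing the two bounds leaves \<open>s * (L - f x) \<le> 4 * L\<close>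
  (\<open>optimal_stretch_inequality\<close>).

  The assumption \<open>r \<ge> 2 / L\<close> makes \<open>N(r, 1)\<close> positive, so a maximizer has at least one
  column. Then \<open>x \<ge> L / 2\<close>, and \<open>L - f x\<close> is at least the positive constant \<open>L - f (L / 2)\<close>:
  maximizers are uniformly bounded above. Being bounded, they satisfy \<open>h = s / r \<rightarrow> 0\<close> as
  \<open>r \<rightarrow> \<infinity>\<close>; since \<open>x\<close> is within \<open>h\<close> of \<open>L\<close>, also \<open>f x \<rightarrow> 0\<close>, and the inequality tends to
  \<open>s \<le> 4\<close>.

  Lower bounds come from reflecting the curve in the diagonal. The inverse function is again
  an intercept curve, and the reflection exchanges \<open>s\<close> and \<open>1 / s\<close>, so an upper bound for the
  maximizers of the inverse function bounds those of \<open>f\<close> from below.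
\<close>

section \<open>Riemann sums of a concave decreasing function\<close>

lemma integral_ge_trapezoid:
  fixes f :: "real \<Rightarrow> real"
  assumes "a \<le> b" and concave: "concave_on {a..b} f" and int: "f integrable_on {a..b}"
  shows "(b - a) * (f a + f b) / 2 \<le> integral {a..b} f"
proof (cases "a = b")
  case False
  define m where "m = (f b - f a) / (b - a)"
  have "((\<lambda>x. m * (x - a) + f a) has_integral
          (m * (b - a)\<^sup>2 / 2 + f a * b) - (m * (a - a)\<^sup>2 / 2 + f a * a)) {a..b}"
    using \<open>a \<le> b\<close>
    by (intro fundamental_theorem_of_calculus)
       (auto intro!: derivative_eq_intros simp flip: has_real_derivative_iff_has_vector_derivative)
  moreover have "(m * (b - a)\<^sup>2 / 2 + f a * b) - (m * (a - a)\<^sup>2 / 2 + f a * a)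
      = (b - a) * (f a + f b) / 2"
  proof -
    have "m * (b - a)\<^sup>2 = (f b - f a) * (b - a)"
      using False by (simp add: m_def power2_eq_square)
    then show ?thesis by (simp add: field_simps)
  qed
  ultimately have "((\<lambda>x. m * (x - a) + f a) has_integral (b - a) * (f a + f b) / 2) {a..b}"
    by (simp only:)
  then show ?thesis
    using concave_onD_Icc'[OF concave] unfolding m_def
    by (intro has_integral_le[OF _ integrable_integral[OF int]])
       auto
qed simp

text \<open>
  Adding the trapezoids over all strips gives the right-endpoint sum plus triangles of area
  \<open>h / 2 * (f ((j - 1) * h) - f (j * h))\<close>, which telescope. Their total is linear in \<open>h\<close>,
  which is what penalizes a large stretch factor.
\<close>

lemma concave_lower_sum_le:
  fixes f :: "real \<Rightarrow> real"
  assumes concave: "concave_on {0..L} f" and int: "f integrable_on {0..L}"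
    and "0 \<le> h" "real n * h \<le> L"
  shows "(\<Sum>j = 1..n. h * f (real j * h)) + h / 2 * (f 0 - f (real n * h))
           \<le> integral {0..real n * h} f"
  using \<open>real n * h \<le> L\<close>
proof (induction n)
  case (Suc n)
  have le: "real n * h \<le> real (Suc n) * h"
    using \<open>0 \<le> h\<close> by (intro mult_right_mono) auto
  have nn: "0 \<le> real n * h"
    using \<open>0 \<le> h\<close> by simp
  have sub: "{real n * h..real (Suc n) * h} \<subseteq> {0..L}" "{0..real (Suc n) * h} \<subseteq> {0..L}"
    using nn Suc.prems by (auto intro: order_trans)
  have "concave_on {real n * h..real (Suc n) * h} f"
    using concave sub(1) unfolding concave_on_def by (rule convex_on_subset) simp
  then have "h * (f (real n * h) + f (real (Suc n) * h)) / 2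
      \<le> integral {real n * h..real (Suc n) * h} f"
    using integral_ge_trapezoid[OF le _
        integrable_on_subinterval[OF int sub(1)]]
    by (simp add: algebra_simps)
  moreover have "integral {0..real n * h} f + integral {real n * h..real (Suc n) * h} f
      = integral {0..real (Suc n) * h} f"
    using Henstock_Kurzweil_Integration.integral_combine[OF nn le
        integrable_on_subinterval[OF int sub(2)]] .
  moreover have "(\<Sum>j = 1..n. h * f (real j * h)) + h / 2 * (f 0 - f (real n * h))
      \<le> integral {0..real n * h} f"
    using Suc le by auto
  ultimately show ?case
    by (simp add: field_simps)
qed simp

lemma integral_le_upper_sum:
  fixes f :: "real \<Rightarrow> real"
  assumes anti: "antimono_on {0..L} f" and int: "f integrable_on {0..L}"
    and "0 \<le> h" "real n * h \<le> L"
  shows "integral {0..real n * h} f \<le> (\<Sum>j<n. h * f (real j * h))"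
  using \<open>real n * h \<le> L\<close>
proof (induction n)
  case (Suc n)
  have le: "real n * h \<le> real (Suc n) * h"
    using \<open>0 \<le> h\<close> by (intro mult_right_mono) auto
  have nn: "0 \<le> real n * h"
    using \<open>0 \<le> h\<close> by simp
  have sub: "{real n * h..real (Suc n) * h} \<subseteq> {0..L}" "{0..real (Suc n) * h} \<subseteq> {0..L}"
    using nn Suc.prems by (auto intro: order_trans)
  have "integral {real n * h..real (Suc n) * h} f
      \<le> integral {real n * h..real (Suc n) * h} (\<lambda>_. f (real n * h))"
    using sub(1) nn le
    by (intro integral_le integrable_on_subinterval[OF int])
       (auto intro!: monotone_onD[OF anti] simp: subset_eq)
  also have "\<dots> = h * f (real n * h)"
    using le by (simp add: algebra_simps)
  finally have "integral {real n * h..real (Suc n) * h} f \<le> h * f (real n * h)" .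
  moreover have "integral {0..real n * h} f + integral {real n * h..real (Suc n) * h} f
      = integral {0..real (Suc n) * h} f"
    using Henstock_Kurzweil_Integration.integral_combine[OF nn le
        integrable_on_subinterval[OF int sub(2)]] .
  moreover have "integral {0..real n * h} f \<le> (\<Sum>j<n. h * f (real j * h))"
    using Suc le by auto
  ultimately show ?case
    by simp
qed simp

section \<open>Intercept curves and their lattice counts\<close>

text \<open>
  The properties of an intercept curve that the estimates use, with monotonicity and range
  in a pointwise form; (9) and (10) are its strict and weak version.
\<close>

lemma intercept_curveD:
  assumes "intercept_curve L f"
  shows "0 < L" "f 0 = L" "f L = 0" "continuous_on {0..L} f" "concave_on {0..L} f"
    "antimono_on {0..L} f" "f integrable_on {0..L}"
    "\<And>x. 0 \<le> x \<Longrightarrow> x \<le> L \<Longrightarrow> 0 \<le> f x \<and> f x \<le> L"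
    "\<And>x y. 0 \<le> x \<Longrightarrow> x < y \<Longrightarrow> y \<le> L \<Longrightarrow> f y < f x"
    "\<And>x y. 0 \<le> x \<Longrightarrow> x \<le> y \<Longrightarrow> y \<le> L \<Longrightarrow> f y \<le> f x"
proof -
  show "0 < L" "f 0 = L" "f L = 0" "continuous_on {0..L} f" "concave_on {0..L} f"
    using assms by (auto simp: intercept_curve_def)
  then show "f integrable_on {0..L}"
    by (intro integrable_continuous_real)
  show "0 \<le> f x \<and> f x \<le> L" if "0 \<le> x" "x \<le> L" for x
    using assms that by (auto simp: intercept_curve_def image_subset_iff)
  show strict: "f y < f x" if "0 \<le> x" "x < y" "y \<le> L" for x y
    using assms that by (auto simp: intercept_curve_def monotone_on_def)
  show weak: "f y \<le> f x" if "0 \<le> x" "x \<le> y" "y \<le> L" for x y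
    using strict[of x y] that by (cases "x = y") auto
  show "antimono_on {0..L} f"
    by (rule monotone_onI) (auto intro: weak)
qed

text \<open>
  Column \<open>j\<close> of the lattice lies over the sample point \<open>j * (s / r)\<close> of the unstretched curve.
\<close>

lemma lattice_count_eq_sum:
  assumes "0 < r" "0 < s"
  shows "lattice_count L f r s
    = (\<Sum>j = 1..nat \<lfloor>L / (s / r)\<rfloor>. nat \<lfloor>r * s * f (real j * (s / r))\<rfloor>)"
proof -
  have floor: "real k \<le> x \<longleftrightarrow> k \<le> nat \<lfloor>x\<rfloor>" if "1 \<le> k" for k x
    using that by linarith
  have "real j * s / r \<le> L \<longleftrightarrow> real j \<le> L / (s / r)" for j
    using assms by (simp add: field_simps)
  then have "{(j, k). 1 \<le> j \<and> 1 \<le> k \<and> real j * s / r \<le> L \<and> real k \<le> r * s * f (real j * s / r)}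
      = (SIGMA j:{1..nat \<lfloor>L / (s / r)\<rfloor>}. {1..nat \<lfloor>r * s * f (real j * (s / r))\<rfloor>})"
    using floor by auto
  then show ?thesis
    unfolding lattice_count_def by (simp add: card_SigmaI)
qed

text \<open>
  Dropping the floors and the area to the right of the last sample point leaves \<open>r\<^sup>2\<close> times the
  deficit estimate for Riemann sums. For a large \<open>s\<close> without any column the last sample point
  is \<open>0\<close>, and the subtracted term vanishes.
\<close>

lemma lattice_count_upper_bound:
  assumes "intercept_curve L f" and "0 < r" "0 < s"
  defines "h \<equiv> s / r"
  shows "lattice_count L f r s
    \<le> r\<^sup>2 * integral {0..L} f - r * s / 2 * (L - f (real (nat \<lfloor>L / h\<rfloor>) * h))"
proof -
  note curve = intercept_curveD[OF assms(1)]
  define n where "n = nat \<lfloor>L / h\<rfloor>"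
  have "0 < h"
    using assms by simp
  have rs: "r * s = r\<^sup>2 * h"
    using assms by (simp add: power2_eq_square)
  have "real n \<le> L / h"
    using \<open>0 < h\<close> \<open>0 < L\<close> by (simp add: n_def)
  then have nL: "real n * h \<le> L"
    using \<open>0 < h\<close> by (simp add: field_simps)
  have jL: "real j * h \<le> L" if "j \<le> n" for j
    using that nL \<open>0 < h\<close> by (meson mult_right_mono of_nat_mono less_imp_le order_trans)
  have "real (lattice_count L f r s) \<le> (\<Sum>j = 1..n. r * s * f (real j * h))"
    unfolding lattice_count_eq_sum[OF \<open>0 < r\<close> \<open>0 < s\<close>] of_nat_sum
    using \<open>0 < r\<close> \<open>0 < s\<close> \<open>0 < h\<close> curve(8) jL
    unfolding n_def[symmetric] h_def[symmetric]
    by (intro sum_mono of_nat_floor) auto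
  also have "\<dots> = r\<^sup>2 * (\<Sum>j = 1..n. h * f (real j * h))"
    by (simp add: rs sum_distrib_left mult.assoc)
  also have "\<dots> \<le> r\<^sup>2 * (integral {0..real n * h} f - h / 2 * (L - f (real n * h)))"
    using concave_lower_sum_le[OF curve(5,7) _ nL] \<open>0 < h\<close> curve(2)
    by (intro mult_left_mono) auto
  also have "\<dots> \<le> r\<^sup>2 * (integral {0..L} f - h / 2 * (L - f (real n * h)))"
    using curve(7,8) \<open>0 < h\<close> nL
    by (intro mult_left_mono diff_right_mono integral_subset_le)
       (auto intro: integrable_on_subinterval)
  also have "\<dots> = r\<^sup>2 * integral {0..L} f - r * s / 2 * (L - f (real n * h))"
    by (simp add: rs right_diff_distrib)
  finally show ?thesis
    by (simp add: n_def)
qed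

text \<open>
  The left Riemann sum with step \<open>1 / r\<close> is at least the area. Its first term contributes \<open>r * L\<close>
  after scaling and has no lattice column; the other terms lose less than \<open>1\<close> each by rounding,
  and there are at most \<open>r * L\<close> of them.
\<close>

lemma lattice_count_lower_bound:
  assumes "intercept_curve L f" and "0 < r"
  shows "r\<^sup>2 * integral {0..L} f - 2 * r * L \<le> lattice_count L f r 1"
proof -
  note curve = intercept_curveD[OF assms(1)]
  define h where "h = 1 / r"
  define n where "n = nat \<lfloor>L / h\<rfloor>"
  have "0 < h" and r: "r = r\<^sup>2 * h"
    using assms by (auto simp: h_def power2_eq_square)
  have n: "real n \<le> L / h" "L / h < real n + 1"
    using \<open>0 < h\<close> \<open>0 < L\<close> by (auto simp: n_def)
  then have nL: "real n * h \<le> L" and Ln: "L - real n * h \<le> h"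
    using \<open>0 < h\<close> by (auto simp: field_simps)
  have nr: "real n \<le> r * L"
    using n(1) by (simp add: h_def mult.commute)
  have nn: "0 \<le> real n * h"
    using \<open>0 < h\<close> by simp
  have "integral {real n * h..L} f \<le> integral {real n * h..L} (\<lambda>_. f (real n * h))"
    using nL nn curve(7,10)
    by (intro integral_le) (auto intro: integrable_on_subinterval)
  also have "\<dots> = (L - real n * h) * f (real n * h)"
    using nL by simp
  also have "\<dots> \<le> h * f (real n * h)"
    using Ln curve(8) nL nn by (intro mult_right_mono) auto
  finally have "integral {real n * h..L} f \<le> h * f (real n * h)" .
  moreover have "integral {0..real n * h} f + integral {real n * h..L} f = integral {0..L} f"
    using Henstock_Kurzweil_Integration.integral_combine[OF nn nL curve(7)] .
  moreover have "integral {0..real n * h} f \<le> (\<Sum>j<n. h * f (real j * h))"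
    using integral_le_upper_sum[OF curve(6,7) _ nL] \<open>0 < h\<close> by simp
  ultimately have "integral {0..L} f \<le> (\<Sum>j<Suc n. h * f (real j * h))"
    by simp
  also have "\<dots> = h * L + (\<Sum>j = 1..n. h * f (real j * h))"
    by (subst sum.lessThan_Suc_shift) (simp add: curve(2) sum.atLeast1_atMost_eq)
  finally have "r\<^sup>2 * integral {0..L} f \<le> r\<^sup>2 * (h * L + (\<Sum>j = 1..n. h * f (real j * h)))"
    by (intro mult_left_mono) auto
  also have "\<dots> = r\<^sup>2 * h * L + (\<Sum>j = 1..n. r\<^sup>2 * h * f (real j * h))"
    by (simp add: algebra_simps sum_distrib_left)
  also have "\<dots> = r * L + (\<Sum>j = 1..n. r * f (real j * h))"
    by (simp flip: r)
  also have "\<dots> \<le> r * L + (\<Sum>j = 1..n. real (nat \<lfloor>r * f (real j * h)\<rfloor>) + 1)"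
    by (intro add_left_mono sum_mono) linarith
  also have "\<dots> = r * L + real n + lattice_count L f r 1"
    unfolding lattice_count_eq_sum[OF \<open>0 < r\<close> zero_less_one] of_nat_sum
    unfolding h_def[symmetric] n_def[symmetric] by (simp add: sum.distrib)
  finally show ?thesis
    using nr by simp
qed

text \<open>
  The point \<open>(1, 1)\<close> is counted, because the curve lies above its chord from \<open>(0, L)\<close> to
  \<open>(L, 0)\<close>, whose midpoint dominates \<open>(1 / r, 1 / r)\<close>.
\<close>

lemma lattice_count_unit_pos:
  assumes "intercept_curve L f" and "2 / L \<le> r"
  shows "0 < lattice_count L f r 1"
proof -
  note curve = intercept_curveD[OF assms(1)]
  have "0 < r"
    using assms(2) curve(1) by (smt (verit) divide_pos_pos)
  have r2: "1 / r \<le> L / 2"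
    using assms(2) \<open>0 < r\<close> curve(1) by (simp add: field_simps)
  have "L / 2 \<le> f (L / 2)"
    using concave_onD[OF curve(5), of "1 / 2" 0 L] curve(1,2,3) by simp
  also have "\<dots> \<le> f (1 / r)"
    using r2 \<open>0 < r\<close> curve(1) by (intro curve(10)) auto
  finally have "1 / r \<le> f (1 / r)"
    using r2 by simp
  then have f: "1 \<le> r * f (1 / r)"
    using \<open>0 < r\<close> by (simp add: pos_divide_le_eq mult.commute)
  have "1 \<le> L / (1 / r)"
    using r2 \<open>0 < r\<close> curve(1) by (simp add: field_simps)
  then have "1 \<in> {1..nat \<lfloor>L / (1 / r)\<rfloor>}"
    by (simp add: le_nat_iff)
  then show ?thesis
    unfolding lattice_count_eq_sum[OF \<open>0 < r\<close> zero_less_one]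
    using f by (intro sum_pos2[of _ 1]) auto
qed

lemma optimal_stretch_iff:
  "s \<in> optimal_stretch L f r
    \<longleftrightarrow> 0 < s \<and> (\<forall>t>0. lattice_count L f r t \<le> lattice_count L f r s)"
  by (simp add: optimal_stretch_def is_arg_max_linorder)

section \<open>Upper bounds on optimal stretch factors\<close>

text \<open>
  The point \<open>x\<close> is the last sample point of the columns for \<open>s\<close>. It is closer to \<open>L\<close> than
  the step \<open>s / r\<close>, which controls it for large \<open>r\<close>; and as there is at least one column, it is
  at least a step away from \<open>0\<close>, hence lies in the right half, which controls it for every \<open>r\<close>.
\<close>

lemma optimal_stretch_inequality:
  assumes "intercept_curve L f" and "2 / L \<le> r" and opt: "s \<in> optimal_stretch L f r"
  obtains x where "L / 2 \<le> x" "L - s / r < x" "x \<le> L" "s * (L - f x) \<le> 4 * L"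
proof -
  note curve = intercept_curveD[OF assms(1)]
  have "0 < r"
    using assms(2) curve(1) by (smt (verit) divide_pos_pos)
  have "0 < s" and max: "lattice_count L f r 1 \<le> lattice_count L f r s"
    using opt by (auto simp: optimal_stretch_iff)
  define h where "h = s / r"
  define n where "n = nat \<lfloor>L / h\<rfloor>"
  have "0 < h"
    using \<open>0 < r\<close> \<open>0 < s\<close> by (simp add: h_def)
  have "n \<noteq> 0"
  proof
    assume "n = 0"
    then have "lattice_count L f r s = 0"
      using lattice_count_eq_sum[OF \<open>0 < r\<close> \<open>0 < s\<close>, of L f] by (simp add: n_def h_def)
    then show False
      using max lattice_count_unit_pos[OF assms(1,2)] by simp
  qed
  then have "1 \<le> real n"
    by simp
  have n: "real n \<le> L / h" "L / h < real n + 1"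
    using \<open>0 < h\<close> \<open>0 < L\<close> by (auto simp: n_def)
  then have nL: "real n * h \<le> L" and Ln: "L < real n * h + h"
    using \<open>0 < h\<close> by (auto simp: field_simps)
  have "h \<le> real n * h"
    using \<open>1 \<le> real n\<close> \<open>0 < h\<close> by simp
  have "r\<^sup>2 * integral {0..L} f - 2 * r * L
      \<le> r\<^sup>2 * integral {0..L} f - r * s / 2 * (L - f (real n * h))"
    using lattice_count_lower_bound[OF assms(1) \<open>0 < r\<close>] max
      lattice_count_upper_bound[OF assms(1) \<open>0 < r\<close> \<open>0 < s\<close>]
    unfolding n_def h_def by linarith
  then have "r * (s * (L - f (real n * h))) \<le> r * (4 * L)"
    by (simp add: field_simps)
  then have "s * (L - f (real n * h)) \<le> 4 * L"
    using \<open>0 < r\<close> by simp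
  moreover have "L / 2 \<le> real n * h" "L - s / r < real n * h"
    using Ln \<open>h \<le> real n * h\<close> unfolding h_def[symmetric] by linarith+
  ultimately show ?thesis
    using nL by (intro that)
qed

lemma optimal_stretch_bounded_above:
  assumes "intercept_curve L f"
  obtains M where "0 < M" "\<And>r s. 2 / L \<le> r \<Longrightarrow> s \<in> optimal_stretch L f r \<Longrightarrow> s \<le> M"
proof -
  note curve = intercept_curveD[OF assms]
  have gap: "0 < L - f (L / 2)"
    using curve(1,2) curve(9)[of 0 "L / 2"] by simp
  show ?thesis
  proof (rule that)
    show "0 < 4 * L / (L - f (L / 2))"
      using gap curve(1) by simp
  next
    fix r s
    assume r: "2 / L \<le> r" and s: "s \<in> optimal_stretch L f r"
    obtain x where x: "L / 2 \<le> x" "L - s / r < x" "x \<le> L" "s * (L - f x) \<le> 4 * L"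
      by (rule optimal_stretch_inequality[OF assms r s])
    have "0 < s"
      using s by (simp add: optimal_stretch_iff)
    have "s * (L - f (L / 2)) \<le> s * (L - f x)"
      using x \<open>0 < s\<close> curve(1) by (auto intro!: curve(10))
    with x(4) show "s \<le> 4 * L / (L - f (L / 2))"
      using gap by (simp add: pos_le_divide_eq)
  qed
qed

text \<open>
  The uniform bound \<open>M\<close> comes first: it forces the step \<open>s / r \<le> M / r\<close> below any \<open>\<delta>\<close>,
  and then the continuity of \<open>f\<close> at \<open>L\<close> makes \<open>f x\<close> negligible.
\<close>

lemma optimal_stretch_le_asymptotically:
  assumes "intercept_curve L f" and "0 < \<epsilon>"
  obtains R where "0 < R" "\<And>r s. R \<le> r \<Longrightarrow> s \<in> optimal_stretch L f r \<Longrightarrow> s \<le> 4 + \<epsilon>"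
proof -
  note curve = intercept_curveD[OF assms(1)]
  obtain M where M: "0 < M" "\<And>r s. 2 / L \<le> r \<Longrightarrow> s \<in> optimal_stretch L f r \<Longrightarrow> s \<le> M"
    by (rule optimal_stretch_bounded_above[OF assms(1)]) blast
  \<comment> \<open>the value of \<open>f x\<close> at which \<open>s * (L - f x) \<le> 4 * L\<close> yields exactly \<open>s \<le> 4 + \<epsilon>\<close>\<close>
  define \<eta> where "\<eta> = \<epsilon> * L / (4 + \<epsilon>)"
  have "0 < \<eta>" and \<eta>: "(4 + \<epsilon>) * (L - \<eta>) = 4 * L"
    using \<open>0 < \<epsilon>\<close> curve(1) by (auto simp: \<eta>_def field_simps)
  obtain \<delta> where "0 < \<delta>" and \<delta>: "\<And>x. x \<in> {0..L} \<Longrightarrow> dist x L < \<delta> \<Longrightarrow> dist (f x) (f L) < \<eta>"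
    using curve(1,4) \<open>0 < \<eta>\<close> unfolding continuous_on_iff by (metis atLeastAtMost_iff less_imp_le order_refl)
  show ?thesis
  proof (rule that)
    show "0 < max (2 / L) (M / \<delta>)"
      using curve(1) by (simp add: less_max_iff_disj)
  next
    fix r s
    assume r: "max (2 / L) (M / \<delta>) \<le> r" and s: "s \<in> optimal_stretch L f r"
    have "0 < r"
      using r curve(1) by (smt (verit) divide_pos_pos)
    have "s \<le> M"
      using M(2)[OF _ s] r by simp
    also have "\<dots> \<le> r * \<delta>"
      using r \<open>0 < \<delta>\<close> by (simp add: pos_divide_le_eq)
    finally have "s / r \<le> \<delta>"
      using \<open>0 < r\<close> by (simp add: field_simps)
    have "0 < s"
      using s by (simp add: optimal_stretch_iff)
    obtain x where x: "L / 2 \<le> x" "L - s / r < x" "x \<le> L" "s * (L - f x) \<le> 4 * L"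
      using r by (auto intro: optimal_stretch_inequality[OF assms(1) _ s])
    have "f x < \<eta>"
      using \<delta>[of x] x \<open>s / r \<le> \<delta>\<close> curve(1,3) by (auto simp: dist_real_def)
    then have "s * (L - \<eta>) \<le> s * (L - f x)"
      using \<open>0 < s\<close> by simp
    also have "\<dots> \<le> (4 + \<epsilon>) * (L - \<eta>)"
      using x \<eta> by simp
    finally show "s \<le> 4 + \<epsilon>"
    proof (rule mult_right_le_imp_le)
      show "0 < L - \<eta>"
        using \<eta> curve(1) \<open>0 < \<epsilon>\<close> by (smt (verit) zero_less_mult_iff)
    qed
  qed
qed

section \<open>Reflection in the diagonal\<close>

text \<open>
  Since \<open>f\<close> is an antitone bijection of \<open>[0, L]\<close>, the region under its graph is, after
  exchanging the axes, the region under the graph of its inverse. This is the second claim, and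
  it also gives concavity: the convex combination of two points on the inverse graph lies in the
  region under \<open>f\<close> because that region is convex, hence in the region under the inverse.
\<close>

lemma intercept_curve_inverse:
  assumes "intercept_curve L f"
  defines "g \<equiv> inv_into {0..L} f"
  shows "intercept_curve L g"
    and "\<And>x y. 0 \<le> x \<Longrightarrow> 0 \<le> y \<Longrightarrow> x \<le> L \<and> y \<le> f x \<longleftrightarrow> y \<le> L \<and> x \<le> g y"
proof -
  note curve = intercept_curveD[OF assms(1)]
  have inj: "inj_on f {0..L}"
    by (rule linorder_inj_onI') (use curve(9) in force)
  have image: "f ` {0..L} = {0..L}"
  proof
    show "{0..L} \<subseteq> f ` {0..L}"
    proof
      fix y assume "y \<in> {0..L}"
      then show "y \<in> f ` {0..L}"
        using IVT2'[of f L y 0] curve(1-4) by fastforce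
    qed
  qed (use curve(8) in auto)
  have g: "0 \<le> g y \<and> g y \<le> L" "f (g y) = y" if "0 \<le> y" "y \<le> L" for y
    using that inv_into_into[of y f "{0..L}"] f_inv_into_f[of y f "{0..L}"] image
    by (auto simp: g_def)
  have gf: "g (f x) = x" if "0 \<le> x" "x \<le> L" for x
    using that inj by (simp add: g_def)
  have f_le_iff: "f x \<le> f y \<longleftrightarrow> y \<le> x" if "0 \<le> x" "x \<le> L" "0 \<le> y" "y \<le> L" for x y
    using that curve(9)[of x y] curve(10)[of y x] by linarith
  show galois: "x \<le> L \<and> y \<le> f x \<longleftrightarrow> y \<le> L \<and> x \<le> g y" if "0 \<le> x" "0 \<le> y" for x y
    using that g[of y] f_le_iff[of "g y" x] curve(8)[of x] by force
  have "continuous_on (f ` {0..L}) g"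
    using curve(4) gf by (intro continuous_on_inv) auto
  moreover have "concave_on {0..L} g"
  proof (rule concave_on_linorderI)
    fix t x y :: real
    assume t: "0 < t" "t < 1" and "x \<in> {0..L}" "y \<in> {0..L}"
    then have x: "0 \<le> x" "x \<le> L" and y: "0 \<le> y" "y \<le> L" by auto
    define u where "u = (1 - t) * g x + t * g y"
    have "(1 - t) * x + t * y \<le> f u"
      using concave_onD[OF curve(5), of t "g x" "g y"] t g x y by (simp add: u_def)
    moreover have "0 \<le> (1 - t) * x + t * y"
      using t x y by simp
    moreover have "0 \<le> u" "u \<le> L"
      using t g[OF x] g[OF y] convex_bound_le[of "g x" L "g y" "1 - t" t] by (auto simp: u_def)
    ultimately show "(1 - t) * g x + t * g y \<le> g ((1 - t) *\<^sub>R x + t *\<^sub>R y)"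
      using galois[of u "(1 - t) * x + t * y"] by (simp add: u_def)
  qed auto
  moreover have "strict_antimono_on {0..L} g"
  proof (rule monotone_onI)
    fix x y assume "x \<in> {0..L}" "y \<in> {0..L}" "x < y"
    then show "g y < g x"
      using f_le_iff[of "g y" "g x"] g[of x] g[of y] by auto
  qed
  moreover have "g 0 = L" "g L = 0"
    using gf[of L] gf[of 0] curve(1-3) by auto
  ultimately show "intercept_curve L g"
    using curve(1) g image by (auto simp: intercept_curve_def)
qed

text \<open>
  Exchanging the coordinates maps the lattice points under the one stretched curve bijectively to
  those under the other.
\<close>

lemma lattice_count_inverse:
  assumes "intercept_curve L f" and "0 < r" "0 < s"
  shows "lattice_count L (inv_into {0..L} f) r (1 / s) = lattice_count L f r s"
proof -
  let ?g = "inv_into {0..L} f"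
  have "real j * (1 / s) / r \<le> L \<and> real k \<le> r * (1 / s) * ?g (real j * (1 / s) / r)
      \<longleftrightarrow> real k * s / r \<le> L \<and> real j \<le> r * s * f (real k * s / r)" for j k
  proof -
    have "real j \<le> r * s * f (real k * s / r) \<longleftrightarrow> real j * (1 / s) / r \<le> f (real k * s / r)"
      "real k \<le> r * (1 / s) * ?g (real j * (1 / s) / r) \<longleftrightarrow> real k * s / r \<le> ?g (real j * (1 / s) / r)"
      using assms(2,3) by (auto simp: field_simps)
    then show ?thesis
      using intercept_curve_inverse(2)[OF assms(1), of "real k * s / r" "real j * (1 / s) / r"] assms(2,3)
      by simp
  qed
  then have "{(j, k). 1 \<le> j \<and> 1 \<le> k \<and> real j * (1 / s) / r \<le> L \<and> real k \<le> r * (1 / s) * ?g (real j * (1 / s) / r)}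
      = prod.swap ` {(j, k). 1 \<le> j \<and> 1 \<le> k \<and> real j * s / r \<le> L \<and> real k \<le> r * s * f (real j * s / r)}"
    by (auto simp: image_iff)
  then show ?thesis
    unfolding lattice_count_def by (simp add: card_image)
qed

lemma optimal_stretch_inverse:
  assumes "intercept_curve L f" and "0 < r" and s: "s \<in> optimal_stretch L f r"
  shows "1 / s \<in> optimal_stretch L (inv_into {0..L} f) r"
proof -
  have "0 < s" and max: "\<And>t. 0 < t \<Longrightarrow> lattice_count L f r t \<le> lattice_count L f r s"
    using s by (auto simp: optimal_stretch_iff)
  have "lattice_count L (inv_into {0..L} f) r t \<le> lattice_count L (inv_into {0..L} f) r (1 / s)"
    if "0 < t" for t
    using max[of "1 / t"] lattice_count_inverse[OF assms(1,2), of "1 / t"]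
      lattice_count_inverse[OF assms(1,2) \<open>0 < s\<close>] that
    by simp
  then show ?thesis
    using \<open>0 < s\<close> by (auto simp: optimal_stretch_iff)
qed

section \<open>Two-sided bounds\<close>

theorem theorem2:
  fixes L :: real and f :: "real \<Rightarrow> real"
  assumes "intercept_curve L f"
  shows "(\<exists>s1>0. \<exists>s2>0. \<forall>r\<ge>2 / L. optimal_stretch L f r \<subseteq> {s1..s2}) \<and>
         (\<forall>\<epsilon>>0. \<exists>r0>0. \<forall>r\<ge>r0. optimal_stretch L f r \<subseteq> {1 / (4 + \<epsilon>)..4 + \<epsilon>})"
proof -
  define g where "g = inv_into {0..L} f"
  have g: "intercept_curve L g"
    using intercept_curve_inverse(1)[OF assms] by (simp add: g_def)
  \<comment> \<open>upper bounds for the reflected curve, read backwards\<close>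
  have lower: "1 / M \<le> s"
    if "0 < M" "0 < r" "s \<in> optimal_stretch L f r"
      and bound: "\<And>t. t \<in> optimal_stretch L g r \<Longrightarrow> t \<le> M" for M r s
  proof -
    have "0 < s"
      using that(3) by (simp add: optimal_stretch_iff)
    have "1 / s \<le> M"
      using optimal_stretch_inverse[OF assms that(2,3)] bound by (simp add: g_def)
    then show ?thesis
      using \<open>0 < s\<close> \<open>0 < M\<close> by (simp add: field_simps)
  qed
  have "\<exists>s1>0. \<exists>s2>0. \<forall>r\<ge>2 / L. optimal_stretch L f r \<subseteq> {s1..s2}"
  proof -
    obtain M where M: "0 < M" "\<And>r s. 2 / L \<le> r \<Longrightarrow> s \<in> optimal_stretch L f r \<Longrightarrow> s \<le> M"
      by (rule optimal_stretch_bounded_above[OF assms]) blast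
    obtain M' where M': "0 < M'" "\<And>r s. 2 / L \<le> r \<Longrightarrow> s \<in> optimal_stretch L g r \<Longrightarrow> s \<le> M'"
      by (rule optimal_stretch_bounded_above[OF g]) blast
    have "optimal_stretch L f r \<subseteq> {1 / M'..M}" if r: "2 / L \<le> r" for r
    proof -
      have "0 < 2 / L"
        using intercept_curveD(1)[OF assms] by simp
      with r have "0 < r"
        by linarith
      then show ?thesis
        using M(2)[OF r] lower[OF M'(1) _ _ M'(2)[OF r]] by auto
    qed
    moreover have "0 < 1 / M'"
      using M'(1) by simp
    ultimately show ?thesis
      using M(1) by blast
  qed
  moreover have "\<exists>r0>0. \<forall>r\<ge>r0. optimal_stretch L f r \<subseteq> {1 / (4 + \<epsilon>)..4 + \<epsilon>}"
    if \<epsilon>: "0 < \<epsilon>" for \<epsilon>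
  proof -
    obtain R where R: "0 < R" "\<And>r s. R \<le> r \<Longrightarrow> s \<in> optimal_stretch L f r \<Longrightarrow> s \<le> 4 + \<epsilon>"
      by (rule optimal_stretch_le_asymptotically[OF assms \<epsilon>]) blast
    obtain R' where R': "0 < R'" "\<And>r s. R' \<le> r \<Longrightarrow> s \<in> optimal_stretch L g r \<Longrightarrow> s \<le> 4 + \<epsilon>"
      by (rule optimal_stretch_le_asymptotically[OF g \<epsilon>]) blast
    have "optimal_stretch L f r \<subseteq> {1 / (4 + \<epsilon>)..4 + \<epsilon>}" if "max R R' \<le> r" for r
      using R(1) R(2)[of r] lower[of "4 + \<epsilon>" r] R'(2)[of r] \<epsilon> that by auto
    moreover have "0 < max R R'"
      using R(1) by simp
    ultimately show ?thesis
      by blast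
  qed
  ultimately show ?thesis
    by blast
qed

end
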